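(* Let $G$ be a compact group and let $f,g:G\to\mathbb{C}$ be continuous functions satisfying the Wilson equation $$f(xy)+f(xy^{-1})=2f(x)g(y)\quad\text{for all } x,y\in G.$$ Then $(f,g)$ is of one of the following forms: (i) $f\equiv 0$ and $g$ is arbitrary; (ii) there are a representation $\varphi:G\to SU(2)$ and a matrix $A\in\mathbb{M}_2(\mathbb{C})$ such that $$f(x)=\operatorname{tr}(A\varphi(x))\quad\text{and}\quad g(x)=\frac{\chi_\varphi(x)}{2}\quad\text{for all } x\in G.$$
   Context: $\mathbb{M}_2(\mathbb{C})$ is the space of all $2\times 2$ complex matrices. All representations are continuous: a representation $\varphi:G\to SU(2)$ is a continuous group homomorphism (not assumed irreducible) into the group $SU(2)$ of $2\times 2$ complex unitary matrices of determinant $1$. Its character is $\chi_\varphi(x)=\operatorname{tr}(\varphi(x))$. *)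

theory Defs
  imports "HOL-Analysis.Analysis" "HOL-Algebra.Group"
begin

(* Compact groups are Hausdorff, following the usual convention. *)

locale topological_group = group G for G :: "('a, 'b) monoid_scheme" (structure) +
  fixes T :: "'a topology"
  assumes topspace_eq: "topspace T = carrier G"
    and continuous_mult: "continuous_map (prod_topology T T) T (\<lambda>(x, y). x \<otimes> y)"
    and continuous_inv: "continuous_map T T (\<lambda>x. inv x)"

locale compact_group = topological_group +
  assumes compact: "compact_space T"
    and Hausdorff: "Hausdorff_space T"

definition adjoint_matrix :: "complex^'n^'m \<Rightarrow> complex^'m^'n" where
  "adjoint_matrix A = map_matrix cnj (transpose A)"

definition unitary_matrix :: "complex^'n^'n \<Rightarrow> bool" where
  "unitary_matrix U \<longleftrightarrow> adjoint_matrix U ** U = mat 1 \<and> U ** adjoint_matrix U = mat 1"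

definition SU2 :: "(complex^2^2) monoid" where
  "SU2 = \<lparr>carrier = {U. unitary_matrix U \<and> det U = 1}, mult = (**), one = mat 1\<rparr>"

definition SU2_representation ::
    "('a, 'b) monoid_scheme \<Rightarrow> 'a topology \<Rightarrow> ('a \<Rightarrow> complex^2^2) \<Rightarrow> bool" where
  "SU2_representation G T \<phi> \<longleftrightarrow>
     \<phi> \<in> hom G SU2 \<and> continuous_map T (top_of_set (carrier SU2)) \<phi>"

definition rep_character :: "('a \<Rightarrow> complex^2^2) \<Rightarrow> 'a \<Rightarrow> complex" where
  "rep_character \<phi> x = trace (\<phi> x)"

lemma adjoint_matrix_mult: "adjoint_matrix (A ** B) = adjoint_matrix B ** adjoint_matrix A"
  by (simp add: adjoint_matrix_def map_matrix_def transpose_def matrix_matrix_mult_def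
      vec_eq_iff mult.commute)

lemma adjoint_matrix_mat_1 [simp]: "adjoint_matrix (mat 1) = mat 1"
  by (simp add: adjoint_matrix_def map_matrix_def transpose_def mat_def vec_eq_iff)

lemma adjoint_matrix_adjoint_matrix [simp]: "adjoint_matrix (adjoint_matrix A) = A"
  by (simp add: adjoint_matrix_def map_matrix_def transpose_def vec_eq_iff)

lemma unitary_matrix_mult:
  assumes "unitary_matrix A" "unitary_matrix B"
  shows "unitary_matrix (A ** B)"
  using assms unfolding unitary_matrix_def adjoint_matrix_mult
  by (metis matrix_mul_assoc matrix_mul_lid)

lemma group_SU2: "group SU2"
proof (rule groupI)
  fix U assume U: "U \<in> carrier SU2"
  have "det (adjoint_matrix U) = cnj (det U)"
    by (simp add: adjoint_matrix_def map_matrix_def transpose_def det_2)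
  then show "\<exists>V\<in>carrier SU2. V \<otimes>\<^bsub>SU2\<^esub> U = \<one>\<^bsub>SU2\<^esub>"
    using U by (intro bexI[of _ "adjoint_matrix U"]) (auto simp: SU2_def unitary_matrix_def)
qed (auto simp: SU2_def det_mul matrix_mul_assoc unitary_matrix_mult, simp add: unitary_matrix_def)

end

theory Submission
  imports Defs
begin

text \<open>If \<open>f\<close> is not identically zero, then \<open>g\<close> is even, and comparing two expansions of
  \<open>f (x y z w) + f (x y\<^sup>-\<^sup>1 z w)\<close> shows that \<open>g\<close> satisfies d'Alembert's equation
  \<open>g (y z) + g (y\<^sup>-\<^sup>1 z) = 2 g y g z\<close>: a defect would make \<open>f\<close> an eigenfunction of a right
  translation, which is incompatible with a defect. Hence on the span of the two-sided translates of
  \<open>f\<close> and \<open>g\<close> the right translations \<open>R\<^sub>y\<close> satisfy \<open>R\<^sub>y + R\<^sub>y\<^sup>-\<^sup>1 = 2 g y\<close>, like elements of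
  \<open>SU(2)\<close> with half-trace \<open>g\<close>. Boundedness forces \<open>g\<close> to be real with values in \<open>[-1, 1]\<close>, and
  makes an element with \<open>g z = 1\<close> act trivially. If some \<open>a\<close>, \<open>b\<close> do not commute in this sense, a
  Gram-Schmidt process on the traceless parts of \<open>R\<^sub>a\<close>, \<open>R\<^sub>b\<close> produces quaternion units
  \<open>E\<^sub>1\<close>, \<open>E\<^sub>2\<close>, \<open>E\<^sub>1 E\<^sub>2\<close>, and every \<open>R\<^sub>y\<close> is a real combination of these and the identity: the
  remainder anticommutes with all three units, so it vanishes. The coefficients form the
  representation \<open>\<phi>\<close>. The degenerate cases give the complex numbers or the scalars
  \<open>1\<close>, \<open>-1\<close> instead of the quaternions.\<close>

section \<open>From Wilson's equation to d'Alembert's equation\<close>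

text \<open>The nonzero value \<open>f x0\<close> permits cancelling \<open>f\<close>. The fourth
  conclusion is the two-sided form that later makes \<open>f\<close> a member of
  \<open>solutions\<close>.\<close>

lemma wilson_dalembert:
  fixes G (structure) and f g :: "'a \<Rightarrow> complex"
  assumes "group G"
    and W: "\<And>x y. \<lbrakk>x \<in> carrier G; y \<in> carrier G\<rbrakk> \<Longrightarrow>
           f (x \<otimes> y) + f (x \<otimes> inv y) = 2 * f x * g y"
    and x0: "x0 \<in> carrier G" "f x0 \<noteq> 0"
  shows "\<And>y. y \<in> carrier G \<Longrightarrow> g (inv y) = g y"
    and "g \<one> = 1"
    and "\<And>y z. \<lbrakk>y \<in> carrier G; z \<in> carrier G\<rbrakk> \<Longrightarrow> g (y \<otimes> z) + g (inv y \<otimes> z) = 2 * g y * g z"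
    and "\<And>x y z. \<lbrakk>x \<in> carrier G; y \<in> carrier G; z \<in> carrier G\<rbrakk> \<Longrightarrow>
           f (x \<otimes> y \<otimes> z) + f (x \<otimes> inv y \<otimes> z) = 2 * g y * f (x \<otimes> z)"
proof -
  interpret group G by fact
  show even: "g (inv y) = g y" if "y \<in> carrier G" for y
    using W[OF x0(1) that] W[OF x0(1) inv_closed[OF that]] x0 that by (simp add: add.commute)
  show "g \<one> = 1"
    using W[OF x0(1) one_closed] x0 by simp
  define D where "D y z = g (y \<otimes> z) + g (inv y \<otimes> z) - 2 * g y * g z" for y z
  \<comment> \<open>Wilson's equation at \<open>y \<otimes> z\<close>, at
    \<open>inv y \<otimes> z\<close> and from the base point \<open>x \<otimes> inv z\<close>; the
    terms with \<open>inv z\<close> cancel and leave the defect \<open>D\<close>.\<close>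
  have A: "f (x \<otimes> y \<otimes> z) + f (x \<otimes> inv y \<otimes> z) = 2 * g y * f (x \<otimes> z) + 2 * f x * D y z"
    if [simp]: "x \<in> carrier G" "y \<in> carrier G" "z \<in> carrier G" for x y z
  proof -
    have 1: "f (x \<otimes> y \<otimes> z) + f (x \<otimes> inv z \<otimes> inv y) = 2 * f x * g (y \<otimes> z)"
      using W[of x "y \<otimes> z"] by (simp add: inv_mult_group m_assoc)
    have 2: "f (x \<otimes> inv y \<otimes> z) + f (x \<otimes> inv z \<otimes> y) = 2 * f x * g (inv y \<otimes> z)"
      using W[of x "inv y \<otimes> z"] by (simp add: inv_mult_group m_assoc)
    have 3: "f (x \<otimes> inv z \<otimes> y) + f (x \<otimes> inv z \<otimes> inv y) = 2 * f (x \<otimes> inv z) * g y"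
      using W[of "x \<otimes> inv z" y] by simp
    have 4: "f (x \<otimes> inv z) = 2 * f x * g z - f (x \<otimes> z)"
      using W[of x z] by (simp add: eq_diff_eq add.commute)
    show ?thesis
      using 1 2 3 unfolding D_def 4 by algebra
  qed
  have D0: "D y z = 0" if [simp]: "y \<in> carrier G" "z \<in> carrier G" for y z
  proof (rule ccontr)
    assume D: "D y z \<noteq> 0"
    \<comment> \<open>The factor of \<open>f x\<close> left over when \<open>A\<close> is applied to
      \<open>y\<close> with \<open>z \<otimes> z\<close> and, regrouped, to
      \<open>y \<otimes> z\<close> and \<open>inv y \<otimes> z\<close> with
      \<open>z\<close>.\<close>
    define C where "C = D y (z \<otimes> z) - D (y \<otimes> z) z - D (inv y \<otimes> z) z + 2 * g y * D z z + 2 * g z * D y z"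
    have eigen: "2 * D y z * f (x \<otimes> z) = C * f x" if [simp]: "x \<in> carrier G" for x
    proof -
      have 1: "f (x \<otimes> y \<otimes> z \<otimes> z) + f (x \<otimes> inv y \<otimes> z \<otimes> z)
          = 2 * g y * f (x \<otimes> z \<otimes> z) + 2 * f x * D y (z \<otimes> z)"
        using A[of x y "z \<otimes> z"] by (simp add: m_assoc)
      have 2: "f (x \<otimes> y \<otimes> z \<otimes> z) + f (x \<otimes> inv z \<otimes> inv y \<otimes> z)
          = 2 * g (y \<otimes> z) * f (x \<otimes> z) + 2 * f x * D (y \<otimes> z) z"
        using A[of x "y \<otimes> z" z] by (simp add: inv_mult_group m_assoc)
      have 3: "f (x \<otimes> inv y \<otimes> z \<otimes> z) + f (x \<otimes> inv z \<otimes> y \<otimes> z)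
          = 2 * g (inv y \<otimes> z) * f (x \<otimes> z) + 2 * f x * D (inv y \<otimes> z) z"
        using A[of x "inv y \<otimes> z" z] by (simp add: inv_mult_group m_assoc)
      have 4: "f (x \<otimes> inv z \<otimes> y \<otimes> z) + f (x \<otimes> inv z \<otimes> inv y \<otimes> z)
          = 2 * g y * f (x \<otimes> inv z \<otimes> z) + 2 * f (x \<otimes> inv z) * D y z"
        using A[of "x \<otimes> inv z" y z] by simp
      have 5: "f (x \<otimes> z \<otimes> z) + f (x \<otimes> inv z \<otimes> z) = 2 * g z * f (x \<otimes> z) + 2 * f x * D z z"
        using A[of x z z] by simp
      have 6: "f (x \<otimes> z) + f (x \<otimes> inv z) = 2 * f x * g z"
        using W[of x z] by simp
      have 7: "D y z = g (y \<otimes> z) + g (inv y \<otimes> z) - 2 * g y * g z"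
        by (simp add: D_def)
      show ?thesis
        using 1 2 3 4 5 6 7 unfolding C_def by algebra
    qed
    define l where "l = C / (2 * D y z)"
    have l: "f (x \<otimes> z) = l * f x" if "x \<in> carrier G" for x
      using eigen[OF that] D by (simp add: l_def field_simps)
    \<comment> \<open>The factor \<open>z\<close> comes out as \<open>l\<close>, so Wilson's
      equation gives the left side of \<open>A\<close> without the defect term.\<close>
    have "f (x0 \<otimes> y \<otimes> z) + f (x0 \<otimes> inv y \<otimes> z) = l * (2 * f x0 * g y)"
      using W[of x0 y] x0 by (simp add: l flip: distrib_left)
    then have "2 * f x0 * D y z = 0"
      using A[of x0 y z] x0 by (simp add: l)
    then show False
      using D x0 by simp
  qed
  show "g (y \<otimes> z) + g (inv y \<otimes> z) = 2 * g y * g z" if "y \<in> carrier G" "z \<in> carrier G" for y z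
    using D0[OF that] by (simp add: D_def)
  show "f (x \<otimes> y \<otimes> z) + f (x \<otimes> inv y \<otimes> z) = 2 * g y * f (x \<otimes> z)"
    if "x \<in> carrier G" "y \<in> carrier G" "z \<in> carrier G" for x y z
    using A[OF that] D0[OF that(2,3)] by simp
qed

text \<open>\<open>p n\<close> is the Chebyshev polynomial T_n at \<open>c\<close>, so
  \<open>2 * p n\<close> is the sum of the \<open>n\<close>-th powers of the roots \<open>l\<close>,
  \<open>m\<close> of X^2 - 2 c X + 1. Boundedness keeps both in the unit disc; as
  \<open>l * m = 1\<close>, they are conjugate points of the unit circle with mean
  \<open>c\<close>.\<close>

lemma bounded_chebyshev_real:
  fixes c :: complex and p :: "nat \<Rightarrow> complex"
  assumes "p 0 = 1" "p 1 = c" and rec: "\<And>n. p (n + 2) = 2 * c * p (n + 1) - p n"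
    and bd: "\<And>n. cmod (p n) \<le> B"
  shows "Im c = 0" and "\<bar>Re c\<bar> \<le> 1"
proof -
  define l where "l = c + csqrt (c\<^sup>2 - 1)"
  define m where "m = c - csqrt (c\<^sup>2 - 1)"
  have lm: "l * m = 1" "l + m = 2 * c"
    by (simp_all add: l_def m_def algebra_simps flip: power2_eq_square)
  have p: "2 * p n = l ^ n + m ^ n \<and> 2 * p (Suc n) = l ^ Suc n + m ^ Suc n" for n
  proof (induction n)
    case (Suc n)
    have "2 * p (Suc (Suc n)) = (l + m) * (2 * p (Suc n)) - (l * m) * (2 * p n)"
      using rec[of n] lm by (simp add: right_diff_distrib)
    also have "\<dots> = l ^ Suc (Suc n) + m ^ Suc (Suc n)"
      using Suc by (simp add: algebra_simps)
    finally show ?case using Suc by simp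
  qed (use assms lm in auto)
  have unit: "cmod a \<le> 1" if ab: "a * b = 1" and pab: "\<And>n. 2 * p n = a ^ n + b ^ n" for a b
  proof (rule ccontr)
    assume "\<not> cmod a \<le> 1"
    then have a: "cmod a > 1" by simp
    moreover have "cmod a * cmod b = 1"
      using ab by (metis norm_mult norm_one)
    ultimately have b: "cmod b \<le> 1"
      by (metis less_eq_real_def linorder_not_less mult_le_cancel_left1 norm_ge_zero
          not_one_le_zero order.trans zero_less_one)
    obtain n where n: "2 * B + 1 < cmod a ^ n"
      using real_arch_pow[OF a] by blast
    have "cmod a ^ n \<le> cmod (a ^ n + b ^ n) + cmod b ^ n"
      using norm_triangle_ineq4[of "a ^ n + b ^ n" "b ^ n"] by (simp add: norm_power)
    also have "\<dots> \<le> 2 * B + 1"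
      using bd[of n] power_le_one[OF _ b, of n] norm_mult[of 2 "p n"] by (simp add: pab[symmetric])
    finally show False using n by simp
  qed
  have "cmod l \<le> 1" "cmod m \<le> 1"
    using unit[of l m] unit[of m l] lm p by (auto simp: mult.commute add.commute)
  moreover have "cmod l * cmod m = 1"
    using lm by (metis norm_mult norm_one)
  ultimately have l1: "cmod l = 1"
    by (smt (verit) mult_left_le norm_ge_zero)
  then have "m = cnj l"
    using lm complex_norm_square[of l] by (metis mult_cancel_left mult_zero_left of_real_1 power_one zero_neq_one)
  then have "2 * c = complex_of_real (2 * Re l)"
    using lm(2) complex_add_cnj by metis
  then have "c = complex_of_real (Re l)"
    by simp
  then show "Im c = 0" "\<bar>Re c\<bar> \<le> 1"
    using l1 abs_Re_le_cmod[of l] by auto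
qed

section \<open>Quaternions as matrices\<close>

lemma continuous_map_compose_continuous_on:
  assumes "continuous_map T euclidean h" "continuous_on UNIV F"
  shows "continuous_map T euclidean (\<lambda>u. F (h u))"
  using continuous_map_compose[of T euclidean h euclidean F] assms by (simp add: o_def)

lemma continuous_map_compact_bounded:
  fixes h :: "'a \<Rightarrow> 'b::metric_space"
  assumes "compact_space T" "continuous_map T euclidean h"
  shows "bounded (h ` topspace T)"
  using image_compactin[of T "topspace T" euclidean h] assms
  by (simp add: compact_space_def compact_imp_bounded)

text \<open>The standard embedding of \<open>a + b i + c j + d k\<close>. Coefficients are complex
  because they will be values of complex functions; realness is demanded only for membership in
  \<open>SU2\<close>.\<close>

definition quaternion_matrix :: "complex \<Rightarrow> complex \<Rightarrow> complex \<Rightarrow> complex \<Rightarrow> complex^2^2" where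
  "quaternion_matrix a b c d = vector [vector [a + \<i> * b, c + \<i> * d], vector [- c + \<i> * d, a - \<i> * b]]"

lemma quaternion_matrix_nth [simp]:
  "quaternion_matrix a b c d $ 1 $ 1 = a + \<i> * b"
  "quaternion_matrix a b c d $ 1 $ 2 = c + \<i> * d"
  "quaternion_matrix a b c d $ 2 $ 1 = - c + \<i> * d"
  "quaternion_matrix a b c d $ 2 $ 2 = a - \<i> * b"
  by (simp_all add: quaternion_matrix_def)

lemma quaternion_matrix_mult:
  "quaternion_matrix a b c d ** quaternion_matrix a' b' c' d' = quaternion_matrix
     (a * a' - b * b' - c * c' - d * d') (a * b' + b * a' + c * d' - d * c')
     (a * c' - b * d' + c * a' + d * b') (a * d' + b * c' - c * b' + d * a')"
proof -
  have [simp]: "\<i> * (\<i> * z) = - z" for z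
    by (simp flip: mult.assoc)
  show ?thesis
    by (simp add: vec_eq_iff forall_2 matrix_matrix_mult_def sum_2 algebra_simps)
qed

lemma quaternion_matrix_one: "quaternion_matrix 1 0 0 0 = mat 1"
  by (simp add: vec_eq_iff forall_2 mat_def)

lemma quaternion_matrix_SU2:
  assumes "a \<in> \<real>" "b \<in> \<real>" "c \<in> \<real>" "d \<in> \<real>" and norm: "a\<^sup>2 + b\<^sup>2 + c\<^sup>2 + d\<^sup>2 = 1"
  shows "quaternion_matrix a b c d \<in> carrier SU2"
proof -
  have adj: "adjoint_matrix (quaternion_matrix a b c d) = quaternion_matrix a (- b) (- c) (- d)"
    using assms by (simp add: vec_eq_iff forall_2 adjoint_matrix_def map_matrix_def transpose_def
        Reals_cnj_iff)
  have "det (quaternion_matrix a b c d) = a\<^sup>2 + b\<^sup>2 + c\<^sup>2 + d\<^sup>2"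
    unfolding det_2 quaternion_matrix_nth using i_squared by algebra
  then show ?thesis
    using norm by (simp add: SU2_def unitary_matrix_def adj quaternion_matrix_mult power2_eq_square
        algebra_simps quaternion_matrix_one)
qed

lemma quaternion_representation:
  fixes G (structure) and q0 q1 q2 q3 :: "'a \<Rightarrow> complex"
  assumes "group G" and top: "topspace T = carrier G"
    and cont: "continuous_map T euclidean q0" "continuous_map T euclidean q1"
      "continuous_map T euclidean q2" "continuous_map T euclidean q3"
    and real: "\<And>x. x \<in> carrier G \<Longrightarrow> q0 x \<in> \<real> \<and> q1 x \<in> \<real> \<and> q2 x \<in> \<real> \<and> q3 x \<in> \<real>"
    and norm: "\<And>x. x \<in> carrier G \<Longrightarrow> (q0 x)\<^sup>2 + (q1 x)\<^sup>2 + (q2 x)\<^sup>2 + (q3 x)\<^sup>2 = 1"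
    and mult: "\<And>x y. \<lbrakk>x \<in> carrier G; y \<in> carrier G\<rbrakk> \<Longrightarrow>
        q0 (x \<otimes> y) = q0 x * q0 y - q1 x * q1 y - q2 x * q2 y - q3 x * q3 y"
      "\<And>x y. \<lbrakk>x \<in> carrier G; y \<in> carrier G\<rbrakk> \<Longrightarrow>
        q1 (x \<otimes> y) = q0 x * q1 y + q1 x * q0 y + q2 x * q3 y - q3 x * q2 y"
      "\<And>x y. \<lbrakk>x \<in> carrier G; y \<in> carrier G\<rbrakk> \<Longrightarrow>
        q2 (x \<otimes> y) = q0 x * q2 y - q1 x * q3 y + q2 x * q0 y + q3 x * q1 y"
      "\<And>x y. \<lbrakk>x \<in> carrier G; y \<in> carrier G\<rbrakk> \<Longrightarrow>
        q3 (x \<otimes> y) = q0 x * q3 y + q1 x * q2 y - q2 x * q1 y + q3 x * q0 y"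
  shows "SU2_representation G T (\<lambda>x. quaternion_matrix (q0 x) (q1 x) (q2 x) (q3 x))"
proof -
  let ?\<phi> = "\<lambda>x. quaternion_matrix (q0 x) (q1 x) (q2 x) (q3 x)"
  have SU2: "?\<phi> x \<in> carrier SU2" if "x \<in> carrier G" for x
    using quaternion_matrix_SU2 real[OF that] norm[OF that] by blast
  have "?\<phi> \<in> hom G SU2"
    using SU2 by (auto simp: hom_def mult SU2_def quaternion_matrix_mult)
  moreover have "continuous_map T euclidean ?\<phi>"
  proof -
    have linear: "continuous_on UNIV F" if "linear F" for F :: "complex \<Rightarrow> complex^2^2"
      using that by (simp add: linear_continuous_on linear_conv_bounded_linear)
    \<comment> \<open>Each summand is real-linear in a single coordinate, hence continuous.\<close>
    have "continuous_map T euclidean (\<lambda>x. quaternion_matrix (q0 x) 0 0 0 + quaternion_matrix 0 (q1 x) 0 0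
        + quaternion_matrix 0 0 (q2 x) 0 + quaternion_matrix 0 0 0 (q3 x))"
      by (intro continuous_map_add cont[THEN continuous_map_compose_continuous_on] linear)
        (auto simp: linear_iff vec_eq_iff forall_2 algebra_simps)
    also have "(\<lambda>x. quaternion_matrix (q0 x) 0 0 0 + quaternion_matrix 0 (q1 x) 0 0
        + quaternion_matrix 0 0 (q2 x) 0 + quaternion_matrix 0 0 0 (q3 x)) = ?\<phi>"
      by (simp add: fun_eq_iff vec_eq_iff forall_2)
    finally show ?thesis .
  qed
  ultimately show ?thesis
    using SU2 by (auto simp: SU2_representation_def continuous_map_in_subtopology top)
qed

text \<open>The matrices of \<open>1, i, j, k\<close> form a basis and the trace pairing is
  nondegenerate, so the four values can be prescribed.\<close>

lemma linear_functional_eq_trace: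
  obtains A :: "complex^2^2"
  where "\<And>a b c d. trace (A ** quaternion_matrix a b c d) = a * k + b * l + c * m + d * n"
proof -
  define A :: "complex^2^2" where "A = vector
    [vector [(k - \<i> * l) / 2, (- m - \<i> * n) / 2], vector [(m - \<i> * n) / 2, (k + \<i> * l) / 2]]"
  have A: "A $ 1 $ 1 = (k - \<i> * l) / 2" "A $ 1 $ 2 = (- m - \<i> * n) / 2"
    "A $ 2 $ 1 = (m - \<i> * n) / 2" "A $ 2 $ 2 = (k + \<i> * l) / 2"
    by (simp_all add: A_def)
  have [simp]: "\<i> * (\<i> * z) = - z" for z
    by (simp flip: mult.assoc)
  have "trace (A ** quaternion_matrix a b c d) = a * k + b * l + c * m + d * n" for a b c d
    by (simp add: trace_def matrix_matrix_mult_def sum_2 A field_simps)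
  then show thesis
    by (rule that)
qed

section \<open>Bounded d'Alembert functions\<close>

text \<open>Boundedness is all that these axioms keep of compactness.\<close>

locale dalembert_function = group G for G (structure) +
  fixes g :: "'a \<Rightarrow> complex"
  assumes g_bounded: "\<exists>B. \<forall>x\<in>carrier G. cmod (g x) \<le> B"
    and g_one [simp]: "g \<one> = 1"
    and g_inv [simp]: "x \<in> carrier G \<Longrightarrow> g (inv x) = g x"
    and dalembert: "\<lbrakk>x \<in> carrier G; y \<in> carrier G\<rbrakk> \<Longrightarrow>
      g (x \<otimes> y) + g (inv x \<otimes> y) = 2 * g x * g y"
begin

text \<open>The extra factor \<open>z\<close> makes this space invariant under translations from both sides.\<close>

definition solutions :: "('a \<Rightarrow> complex) set" where
  "solutions = {h. (\<exists>B. \<forall>x\<in>carrier G. cmod (h x) \<le> B) \<and>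
     (\<forall>x\<in>carrier G. \<forall>y\<in>carrier G. \<forall>z\<in>carrier G.
        h (x \<otimes> y \<otimes> z) + h (x \<otimes> inv y \<otimes> z) = 2 * g y * h (x \<otimes> z))}"

lemma solutions_eq:
  assumes "h \<in> solutions" "x \<in> carrier G" "y \<in> carrier G" "z \<in> carrier G"
  shows "h (x \<otimes> y \<otimes> z) + h (x \<otimes> inv y \<otimes> z) = 2 * g y * h (x \<otimes> z)"
  using assms by (simp add: solutions_def)

lemma solutions_eq_right:
  assumes "h \<in> solutions" "x \<in> carrier G" "y \<in> carrier G"
  shows "h (x \<otimes> y) + h (x \<otimes> inv y) = 2 * g y * h x"
  using solutions_eq[of h x y \<one>] assms by simp

lemma solutions_bounded:
  assumes "h \<in> solutions"
  obtains B where "\<And>x. x \<in> carrier G \<Longrightarrow> cmod (h x) \<le> B"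
  using assms unfolding solutions_def by blast

lemma g_commute:
  assumes [simp]: "x \<in> carrier G" "y \<in> carrier G"
  shows "g (x \<otimes> y) = g (y \<otimes> x)"
proof -
  have "g (inv x \<otimes> y) = g (inv y \<otimes> x)"
    using g_inv[of "inv x \<otimes> y"] by (simp add: inv_mult_group)
  then have "2 * g x * g y - g (inv x \<otimes> y) = 2 * g y * g x - g (inv y \<otimes> x)"
    by (simp add: mult_ac)
  then show ?thesis
    using dalembert[OF assms] dalembert[OF assms(2,1)] by (metis add_diff_cancel_right')
qed

text \<open>\<open>g_commute\<close> moves \<open>x\<close> behind \<open>z\<close>, which leaves
  d'Alembert's equation at \<open>y\<close> and \<open>z \<otimes> x\<close>.\<close>

lemma g_in_solutions [simp]: "g \<in> solutions"
proof -
  have "g (x \<otimes> y \<otimes> z) + g (x \<otimes> inv y \<otimes> z) = 2 * g y * g (x \<otimes> z)"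
    if [simp]: "x \<in> carrier G" "y \<in> carrier G" "z \<in> carrier G" for x y z
    using dalembert[of y "z \<otimes> x"] g_commute[of x "y \<otimes> z"] g_commute[of x "inv y \<otimes> z"]
      g_commute[of x z] by (simp add: m_assoc)
  then show ?thesis
    using g_bounded by (simp add: solutions_def)
qed

text \<open>Cayley-Hamilton for right translation by \<open>y\<close>, with trace
  \<open>2 * g y\<close> and determinant \<open>1\<close>.\<close>

lemma solutions_square:
  assumes "h \<in> solutions" "x \<in> carrier G" "y \<in> carrier G"
  shows "h (x \<otimes> y \<otimes> y) = 2 * g y * h (x \<otimes> y) - h x"
  using solutions_eq_right[of h "x \<otimes> y" y] assms by (simp add: m_assoc eq_diff_eq)

text \<open>The polarized Cayley-Hamilton identity of two by two matrices, with \<open>g\<close> as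
  half the trace.\<close>

lemma solutions_swap:
  assumes h: "h \<in> solutions" and [simp]: "u \<in> carrier G" "x \<in> carrier G" "y \<in> carrier G"
  shows "h (u \<otimes> x \<otimes> y) + h (u \<otimes> y \<otimes> x)
    = 2 * g x * h (u \<otimes> y) + 2 * g y * h (u \<otimes> x) + (2 * g (x \<otimes> y) - 4 * g x * g y) * h u"
proof -
  have 1: "h (u \<otimes> x \<otimes> y) + h (u \<otimes> inv y \<otimes> inv x) = 2 * g (x \<otimes> y) * h u"
    using solutions_eq_right[OF h, of u "x \<otimes> y"] by (simp add: m_assoc inv_mult_group)
  have 2: "h (u \<otimes> inv y \<otimes> x) + h (u \<otimes> inv y \<otimes> inv x) = 2 * g x * h (u \<otimes> inv y)"
    using solutions_eq_right[OF h, of "u \<otimes> inv y" x] by simp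
  have 3: "h (u \<otimes> y \<otimes> x) + h (u \<otimes> inv y \<otimes> x) = 2 * g y * h (u \<otimes> x)"
    using solutions_eq[OF h, of u y x] by simp
  have 4: "h (u \<otimes> y) + h (u \<otimes> inv y) = 2 * g y * h u"
    using solutions_eq_right[OF h, of u y] by simp
  show ?thesis
    using 1 2 3 4 by algebra
qed

lemma g_real:
  assumes [simp]: "x \<in> carrier G"
  shows "Im (g x) = 0" "\<bar>Re (g x)\<bar> \<le> 1"
proof -
  obtain B where B: "\<And>y. y \<in> carrier G \<Longrightarrow> cmod (g y) \<le> B"
    using g_bounded by blast
  have "g (x [^] (n + 2)) = 2 * g x * g (x [^] (n + 1)) - g (x [^] n)" for n :: nat
    using solutions_square[of g "x [^] n" x] by simp
  then show "Im (g x) = 0" "\<bar>Re (g x)\<bar> \<le> 1"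
    using bounded_chebyshev_real[of "\<lambda>n. g (x [^] n)" "g x" B] B by auto
qed

text \<open>The values along the powers of \<open>z\<close> form an arithmetic progression, which is bounded only if it
  is constant.\<close>

lemma solutions_fixed:
  assumes h: "h \<in> solutions" and [simp]: "u \<in> carrier G" "z \<in> carrier G" and z: "g z = 1"
  shows "h (u \<otimes> z) = h u"
proof -
  obtain B where B: "\<And>x. x \<in> carrier G \<Longrightarrow> cmod (h x) \<le> B"
    using solutions_bounded[OF h] by blast
  define d where "d = h (u \<otimes> z) - h u"
  have step: "h (u \<otimes> z [^] n) = h u + of_nat n * d \<and> h (u \<otimes> z [^] Suc n) = h u + of_nat (Suc n) * d"
    for n :: nat
  proof (induction n)
    case (Suc n)
    have "h (u \<otimes> z [^] Suc (Suc n)) = 2 * h (u \<otimes> z [^] Suc n) - h (u \<otimes> z [^] n)"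
      using solutions_square[OF h, of "u \<otimes> z [^] n" z] by (simp add: z m_assoc)
    also have "\<dots> = h u + of_nat (Suc (Suc n)) * d"
      unfolding Suc.IH[THEN conjunct1] Suc.IH[THEN conjunct2] by (simp add: algebra_simps)
    finally show ?case
      using Suc by blast
  qed (simp add: d_def)
  have "real n * cmod d \<le> 2 * B" for n :: nat
  proof -
    have "of_nat n * d = h (u \<otimes> z [^] n) - h u"
      using step[of n] by simp
    then have "real n * cmod d = cmod (h (u \<otimes> z [^] n) - h u)"
      by (metis norm_mult norm_of_nat)
    also have "\<dots> \<le> 2 * B"
      using norm_triangle_ineq4[of "h (u \<otimes> z [^] n)" "h u"] B[of "u \<otimes> z [^] n"] B[of u] by simp
    finally show ?thesis .
  qed
  then have "cmod d = 0"
    by (metis norm_ge_zero order_less_le reals_Archimedean3 linorder_not_less)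
  then show ?thesis
    by (simp add: d_def)
qed

text \<open>The classical trace identity for commutators. The bracket is the Gram determinant of the
  traceless parts of \<open>x\<close> and \<open>y\<close>; where it vanishes, \<open>g\<close> is
  \<open>1\<close> at the commutator.\<close>

lemma g_commutator:
  assumes [simp]: "x \<in> carrier G" "y \<in> carrier G"
  shows "g (x \<otimes> y \<otimes> inv (y \<otimes> x))
    = 1 - 2 * (1 - (g x)\<^sup>2 - (g y)\<^sup>2 + 2 * g x * g y * g (x \<otimes> y) - (g (x \<otimes> y))\<^sup>2)"
proof -
  have 1: "g (x \<otimes> y \<otimes> (y \<otimes> x)) + g (x \<otimes> y \<otimes> inv (y \<otimes> x)) = 2 * g (x \<otimes> y) * g (x \<otimes> y)"
    using solutions_eq_right[of g "x \<otimes> y" "y \<otimes> x"] by (simp add: g_commute[of y x])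
  have 2: "g (x \<otimes> y \<otimes> (y \<otimes> x)) = 2 * g y * g (x \<otimes> y \<otimes> x) - g (x \<otimes> x)"
    using solutions_square[of g x y] solutions_eq[of g "x \<otimes> y" y x]  by (simp add: m_assoc eq_diff_eq)
  have 3: "g (x \<otimes> y \<otimes> x) = 2 * g x * g (x \<otimes> y) - g y"
    using solutions_square[of g y x] g_commute[of "x \<otimes> y" x] g_commute[of x y] g_commute[of "y \<otimes> x" x]
    by (simp add: m_assoc)
  have 4: "g (x \<otimes> x) = 2 * g x * g x - 1"
    using solutions_square[of g \<one> x] by simp
  show ?thesis
    using 1 unfolding 2 3 4 by algebra
qed

section \<open>The algebra of right translations\<close>

text \<open>The rule \<open>extensional\<close> is needed because functions are unconstrained outside the carrier, where
  for instance \<open>h (u \<otimes> \<one>) = h u\<close> may fail. The value \<open>E g \<one>\<close> plays the role of half the trace of \<open>E\<close>.\<close>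

inductive_set Ops :: "(('a \<Rightarrow> complex) \<Rightarrow> 'a \<Rightarrow> complex) set" where
  translation: "y \<in> carrier G \<Longrightarrow> (\<lambda>h u. h (u \<otimes> y)) \<in> Ops"
| combination: "\<lbrakk>E \<in> Ops; F \<in> Ops\<rbrakk> \<Longrightarrow> (\<lambda>h u. c * E h u + d * F h u) \<in> Ops"
| extensional: "\<lbrakk>E \<in> Ops; \<And>h u. u \<in> carrier G \<Longrightarrow> F h u = E h u\<rbrakk> \<Longrightarrow> F \<in> Ops"

lemma Ops_scale: "E \<in> Ops \<Longrightarrow> (\<lambda>h u. c * E h u) \<in> Ops"
  using combination[of E E c 0] by simp

lemma Ops_add: "\<lbrakk>E \<in> Ops; F \<in> Ops\<rbrakk> \<Longrightarrow> (\<lambda>h u. E h u + F h u) \<in> Ops"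
  using combination[of E F 1 1] by simp

lemma Ops_diff: "\<lbrakk>E \<in> Ops; F \<in> Ops\<rbrakk> \<Longrightarrow> (\<lambda>h u. E h u - F h u) \<in> Ops"
  using combination[of E F 1 "-1"] by simp

lemma Ops_divide: "E \<in> Ops \<Longrightarrow> (\<lambda>h u. E h u / c) \<in> Ops"
  using Ops_scale[of E "inverse c"] by (simp add: divide_inverse mult.commute)

lemma Ops_id: "(\<lambda>h. h) \<in> Ops"
  by (rule extensional[OF translation[OF one_closed]]) simp

lemmas Ops_intros = translation Ops_scale Ops_add Ops_diff Ops_divide Ops_id

lemma Ops_linear:
  "\<lbrakk>E \<in> Ops; u \<in> carrier G\<rbrakk> \<Longrightarrow> E (\<lambda>v. c * h v + d * k v) u = c * E h u + d * E k u"
  by (induction arbitrary: u rule: Ops.induct) (auto simp: algebra_simps)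

lemma Ops_cong:
  "\<lbrakk>E \<in> Ops; \<And>v. v \<in> carrier G \<Longrightarrow> h v = k v; u \<in> carrier G\<rbrakk> \<Longrightarrow> E h u = E k u"
  by (induction arbitrary: u rule: Ops.induct) auto

text \<open>Translations compose to translations; an induction on each factor extends this
  bilinearly, so \<open>Ops\<close> is an algebra.\<close>

lemma Ops_comp: "E \<in> Ops \<Longrightarrow> F \<in> Ops \<Longrightarrow> (\<lambda>h. E (F h)) \<in> Ops"
proof (induction rule: Ops.induct)
  case (translation y)
  from translation(2,1) show ?case
  proof (induction rule: Ops.induct)
    case (translation z)
    then show ?case
      by (intro extensional[OF Ops.translation[of "y \<otimes> z"]]) (auto simp: m_assoc)
  next
    case (combination E F c d)
    then show ?case by (intro Ops.combination) auto
  next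
    case (extensional E F)
    then show ?case by (intro Ops.extensional[of "\<lambda>h u. E h (u \<otimes> y)" "\<lambda>h u. F h (u \<otimes> y)"]) auto
  qed
next
  case (combination E E' c d)
  then show ?case by (intro Ops.combination) auto
next
  case (extensional E E')
  show ?case
    by (rule Ops.extensional[OF extensional.IH[OF extensional.prems]]) (use extensional in auto)
qed

lemma solutions_translation:
  assumes h: "h \<in> solutions" and y: "y \<in> carrier G"
  shows "(\<lambda>u. h (u \<otimes> y)) \<in> solutions"
  using h y solutions_eq[OF h] solutions_bounded[OF h] unfolding solutions_def
  by (auto simp: m_assoc)

lemma solutions_combination:
  assumes h: "h \<in> solutions" and k: "k \<in> solutions"
  shows "(\<lambda>u. c * h u + d * k u) \<in> solutions"
proof -
  obtain B where B: "\<And>x. x \<in> carrier G \<Longrightarrow> cmod (h x) \<le> B"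
    using solutions_bounded[OF h] by blast
  obtain C where C: "\<And>x. x \<in> carrier G \<Longrightarrow> cmod (k x) \<le> C"
    using solutions_bounded[OF k] by blast
  have "cmod (c * h x + d * k x) \<le> cmod c * B + cmod d * C" if "x \<in> carrier G" for x
    using B[OF that] C[OF that]
    by (metis add_mono mult_left_mono norm_ge_zero norm_mult norm_triangle_mono)
  moreover have "c * h (x \<otimes> y \<otimes> z) + d * k (x \<otimes> y \<otimes> z) + (c * h (x \<otimes> inv y \<otimes> z) + d * k (x \<otimes> inv y \<otimes> z))
      = 2 * g y * (c * h (x \<otimes> z) + d * k (x \<otimes> z))"
    if "x \<in> carrier G" "y \<in> carrier G" "z \<in> carrier G" for x y z
    using solutions_eq[OF h that] solutions_eq[OF k that] by algebra
  ultimately show ?thesis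
    unfolding solutions_def by blast
qed

lemma solutions_ext:
  assumes h: "h \<in> solutions" and "\<And>x. x \<in> carrier G \<Longrightarrow> k x = h x"
  shows "k \<in> solutions"
  using h assms(2) by (simp add: solutions_def)

lemma Ops_solutions: "E \<in> Ops \<Longrightarrow> h \<in> solutions \<Longrightarrow> E h \<in> solutions"
proof (induction rule: Ops.induct)
  case (extensional E F)
  then show ?case using solutions_ext by metis
qed (auto intro: solutions_translation solutions_combination)

lemma Ops_continuous:
  assumes "topological_group G T"
  shows "E \<in> Ops \<Longrightarrow> continuous_map T euclidean h \<Longrightarrow> continuous_map T euclidean (E h)"
proof (induction rule: Ops.induct)
  interpret topological_group G T by fact
  {
    case (translation y)
    have "continuous_map T T (\<lambda>u. u \<otimes> y)"
      using continuous_map_compose[OF continuous_map_pairedI[OF continuous_map_id continuous_map_const[THEN iffD2]]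
          continuous_mult, of y] translation topspace_eq by (simp add: o_def)
    then show ?case
      using translation(2) continuous_map_compose[of T T "\<lambda>u. u \<otimes> y" euclidean h] by (simp add: o_def)
  next
    case (combination E F c d)
    then show ?case
      by (intro continuous_map_add continuous_map_compose_continuous_on[where F = "(*) _"]
          continuous_intros) auto
  next
    case (extensional E F)
    then show ?case
      using continuous_map_eq[of T euclidean "E h" "F h"] topspace_eq by auto
  }
qed

text \<open>d'Alembert's equation extended linearly from translations; for traceless
  \<open>E\<close> it makes \<open>E g\<close> odd under inversion.\<close>

lemma Ops_inv:
  "E \<in> Ops \<Longrightarrow> y \<in> carrier G \<Longrightarrow> E g y + E g (inv y) = 2 * g y * E g \<one>"
proof (induction rule: Ops.induct)
  case (translation x)
  then show ?case using dalembert[of y x] by simp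
qed (auto simp: algebra_simps simp flip: distrib_left)

text \<open>\<open>solutions_swap\<close> is bilinear in the two translations;
  \<open>E (F g) \<one>\<close> takes the place of \<open>g (x \<otimes> y)\<close>.\<close>

lemma Ops_swap:
  assumes h: "h \<in> solutions"
  shows "\<lbrakk>E \<in> Ops; F \<in> Ops; u \<in> carrier G\<rbrakk> \<Longrightarrow> E (F h) u + F (E h) u
    = 2 * E g \<one> * F h u + 2 * F g \<one> * E h u + (2 * E (F g) \<one> - 4 * E g \<one> * F g \<one>) * h u"
proof (induction rule: Ops.induct)
  case (translation x)
  from translation(2,3,1) show ?case
  proof (induction arbitrary: u rule: Ops.induct)
    case (translation y)
    then show ?case using solutions_swap[OF h, of u x y] by (simp add: add_ac)
  next
    case (combination E F c d)
    have x: "x \<in> carrier G" by fact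
    show ?case
      using combination.IH[OF combination.prems(1) x] unfolding l_one[OF x] by algebra
  next
    case (extensional E F)
    then show ?case by simp
  qed
next
  case (combination E E' c d)
  have "F (\<lambda>v. c * E h v + d * E' h v) u = c * F (E h) u + d * F (E' h) u"
    using combination by (intro Ops_linear)
  then show ?case
    using combination.IH[OF combination.prems] by algebra
next
  case (extensional E E')
  have "F (E' h) u = F (E h) u"
    by (rule Ops_cong) (use extensional in auto)
  then show ?case using extensional by simp
qed

text \<open>A Clifford relation. With \<open>E\<close> and \<open>F\<close> equal, it says that
  traceless operators have scalar squares.\<close>

lemma Ops_anticommute:
  assumes "E \<in> Ops" "F \<in> Ops" "E g \<one> = 0" "F g \<one> = 0" "h \<in> solutions" "u \<in> carrier G"
  shows "F (E h) u = 2 * E (F g) \<one> * h u - E (F h) u"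
  using Ops_swap[OF assms(5,1,2,6)] assms by (simp add: eq_diff_eq add.commute)

text \<open>At \<open>h = g\<close> and \<open>u = \<one>\<close> the right side of
  \<open>Ops_swap\<close> collapses to \<open>2 * E (F g) \<one>\<close>.\<close>

lemma Ops_trace_commute:
  assumes "E \<in> Ops" "F \<in> Ops"
  shows "E (F g) \<one> = F (E g) \<one>"
  using Ops_swap[OF g_in_solutions assms one_closed] Ops_swap[OF g_in_solutions assms(2,1) one_closed]
  by (simp add: algebra_simps)

lemma g_in_Reals: "x \<in> carrier G \<Longrightarrow> g x \<in> \<real>"
  using g_real by (simp add: complex_is_Real_iff)

end

section \<open>Quaternion units\<close>

text \<open>The coordinates of the representation in the basis \<open>1, i, j, k\<close> are
  \<open>g\<close>, \<open>- E1 g\<close>, \<open>- E2 g\<close> and \<open>- E3 g\<close>. Zero operators are allowed, for representations by complex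
  numbers or scalars.\<close>

locale quaternion_system = dalembert_function +
  fixes E1 E2 E3 :: "('a \<Rightarrow> complex) \<Rightarrow> 'a \<Rightarrow> complex"
  assumes Ops: "E1 \<in> Ops" "E2 \<in> Ops" "E3 \<in> Ops"
    and trace_zero: "E1 g \<one> = 0" "E2 g \<one> = 0" "E3 g \<one> = 0"
    and in_Reals: "\<And>x. x \<in> carrier G \<Longrightarrow> E1 g x \<in> \<real> \<and> E2 g x \<in> \<real> \<and> E3 g x \<in> \<real>"
    and expand: "\<And>h x y. \<lbrakk>h \<in> solutions; x \<in> carrier G; y \<in> carrier G\<rbrakk> \<Longrightarrow> h (x \<otimes> y)
        = g y * h x - E1 g y * E1 h x - E2 g y * E2 h x - E3 g y * E3 h x"
    and multiplicative: "\<And>x y. \<lbrakk>x \<in> carrier G; y \<in> carrier G\<rbrakk> \<Longrightarrow>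
        E1 g (x \<otimes> y) = g x * E1 g y + E1 g x * g y - E2 g x * E3 g y + E3 g x * E2 g y"
      "\<And>x y. \<lbrakk>x \<in> carrier G; y \<in> carrier G\<rbrakk> \<Longrightarrow>
        E2 g (x \<otimes> y) = g x * E2 g y + E1 g x * E3 g y + E2 g x * g y - E3 g x * E1 g y"
      "\<And>x y. \<lbrakk>x \<in> carrier G; y \<in> carrier G\<rbrakk> \<Longrightarrow>
        E3 g (x \<otimes> y) = g x * E3 g y - E1 g x * E2 g y + E2 g x * E1 g y + E3 g x * g y"

lemma (in quaternion_system) SU2_representation_exists:
  assumes T: "topological_group G T" and cont: "continuous_map T euclidean g" and f: "f \<in> solutions"
  shows "\<exists>\<phi> (A :: complex^2^2). SU2_representation G T \<phi> \<and>
            (\<forall>x\<in>carrier G. f x = trace (A ** \<phi> x) \<and> g x = rep_character \<phi> x / 2)"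
proof -
  interpret T: topological_group G T by fact
  \<comment> \<open>The coordinate of a quaternion along the unit \<open>i\<close> is minus the real
    part of \<open>i\<close> times it; hence the sign.\<close>
  define q where "q E x = - E g x" for E :: "('a \<Rightarrow> complex) \<Rightarrow> 'a \<Rightarrow> complex" and x
  define \<phi> where "\<phi> x = quaternion_matrix (g x) (q E1 x) (q E2 x) (q E3 x)" for x
  have cq: "continuous_map T euclidean (q E)" if "E \<in> Ops" for E
    using continuous_map_minus[OF Ops_continuous[OF T that cont]] by (simp add: q_def[abs_def])
  have inv: "E g (inv y) = - E g y" if "E \<in> Ops" "E g \<one> = 0" "y \<in> carrier G" for E y
    using Ops_inv[OF that(1,3)] that(2) by (simp add: eq_neg_iff_add_eq_0 add.commute)
  have "SU2_representation G T \<phi>"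
    unfolding \<phi>_def
  proof (rule quaternion_representation)
    fix x assume x: "x \<in> carrier G"
    show "g x \<in> \<real> \<and> q E1 x \<in> \<real> \<and> q E2 x \<in> \<real> \<and> q E3 x \<in> \<real>"
      using in_Reals[OF x] g_in_Reals[OF x] by (simp add: q_def)
    \<comment> \<open>\<open>expand\<close> evaluates \<open>g (x \<otimes> inv x) = 1\<close>, and
      each \<open>E g\<close> changes sign at \<open>inv x\<close>.\<close>
    show "(g x)\<^sup>2 + (q E1 x)\<^sup>2 + (q E2 x)\<^sup>2 + (q E3 x)\<^sup>2 = 1"
      using expand[OF g_in_solutions x inv_closed[OF x]] x
      by (simp add: q_def inv Ops trace_zero power2_eq_square)
    fix y assume y: "y \<in> carrier G"
    show "g (x \<otimes> y) = g x * g y - q E1 x * q E1 y - q E2 x * q E2 y - q E3 x * q E3 y"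
      using expand[OF g_in_solutions x y] by (simp add: q_def mult.commute)
  qed (simp_all add: cq Ops cont T.topspace_eq is_group, simp_all add: q_def multiplicative)
  \<comment> \<open>\<open>A\<close> encodes the values at \<open>\<one>\<close> of \<open>f\<close>
    and its images, so expanding \<open>f (\<one> \<otimes> x)\<close> gives the trace
    formula.\<close>
  moreover obtain A :: "complex^2^2"
    where A: "\<And>a b c d. trace (A ** quaternion_matrix a b c d)
      = a * f \<one> + b * E1 f \<one> + c * E2 f \<one> + d * E3 f \<one>"
    using linear_functional_eq_trace by metis
  moreover have "f x = trace (A ** \<phi> x)" if "x \<in> carrier G" for x
    using expand[OF f one_closed that] that by (simp add: A \<phi>_def q_def)
  moreover have "g x = rep_character \<phi> x / 2" for x
    by (simp add: rep_character_def trace_def sum_2 \<phi>_def)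
  ultimately show ?thesis by blast
qed

section \<open>Existence of quaternion units\<close>

context dalembert_function
begin

text \<open>Orthonormal traceless \<open>E1\<close>, \<open>E2\<close> satisfy the quaternion
  relations, with their product as third unit. The hypothesis \<open>real\<close> covers all
  real-valued \<open>h\<close> because \<open>E1\<close> is also applied to
  \<open>E2 g\<close>.\<close>

lemma quaternion_system_noncommuting:
  assumes Ops: "E1 \<in> Ops" "E2 \<in> Ops" and tr: "E1 g \<one> = 0" "E2 g \<one> = 0"
    and orth: "E1 (E1 g) \<one> = - 1" "E2 (E2 g) \<one> = - 1" "E1 (E2 g) \<one> = 0"
    and real: "\<And>h x. \<lbrakk>\<And>y. y \<in> carrier G \<Longrightarrow> h y \<in> \<real>; x \<in> carrier G\<rbrakk> \<Longrightarrow> E1 h x \<in> \<real>"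
      "\<And>h x. \<lbrakk>\<And>y. y \<in> carrier G \<Longrightarrow> h y \<in> \<real>; x \<in> carrier G\<rbrakk> \<Longrightarrow> E2 h x \<in> \<real>"
  shows "quaternion_system G g E1 E2 (\<lambda>h. E1 (E2 h))"
proof -
  have linear: "E (\<lambda>v. - h v) u = - E h u" if "E \<in> Ops" "u \<in> carrier G" for E h u
    using Ops_linear[OF that, of "-1" h 0 h] by simp
  have E11: "E1 (E1 h) u = - h u" if "h \<in> solutions" "u \<in> carrier G" for h u
    using Ops_anticommute[OF Ops(1,1) tr(1,1) that] orth by simp
  have E22: "E2 (E2 h) u = - h u" if "h \<in> solutions" "u \<in> carrier G" for h u
    using Ops_anticommute[OF Ops(2,2) tr(2,2) that] orth by simp
  have E21: "E2 (E1 h) u = - E1 (E2 h) u" if "h \<in> solutions" "u \<in> carrier G" for h u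
    using Ops_anticommute[OF Ops tr that] orth by simp
  have E121: "E1 (E2 (E1 h)) u = E2 h u" if "h \<in> solutions" "u \<in> carrier G" for h u
  proof -
    have "E1 (E2 (E1 h)) u = E1 (\<lambda>v. - E1 (E2 h) v) u"
      by (rule Ops_cong) (use Ops E21 that in auto)
    then show ?thesis
      using that Ops by (simp add: linear E11 Ops_solutions)
  qed
  have E122: "E1 (E2 (E2 h)) u = - E1 h u" if "h \<in> solutions" "u \<in> carrier G" for h u
  proof -
    have "E1 (E2 (E2 h)) u = E1 (\<lambda>v. - h v) u"
      by (rule Ops_cong) (use Ops E22 that in auto)
    then show ?thesis
      using that Ops by (simp add: linear)
  qed
  have E112: "E1 (E1 (E2 h)) u = - E2 h u" if "h \<in> solutions" "u \<in> carrier G" for h u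
    using that Ops by (simp add: E11 Ops_solutions)
  have E212: "E2 (E1 (E2 h)) u = E1 h u" if "h \<in> solutions" "u \<in> carrier G" for h u
    using that Ops by (simp add: E21 E122 Ops_solutions)
  have E1212: "E1 (E2 (E1 (E2 h))) u = - h u" if "h \<in> solutions" "u \<in> carrier G" for h u
    using that Ops by (simp add: E121 E22 Ops_solutions)
  define E3 where "E3 h = E1 (E2 h)" for h
  have Ops3: "E3 \<in> Ops"
    unfolding E3_def[abs_def] by (rule Ops_comp[OF Ops])
  have expand: "h (x \<otimes> y) = g y * h x - E1 g y * E1 h x - E2 g y * E2 h x - E3 g y * E3 h x"
    if h: "h \<in> solutions" and x: "x \<in> carrier G" and y: "y \<in> carrier G" for h x y
  proof -
    \<comment> \<open>The remainder of translation by \<open>y\<close> once its components along the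
      identity and the three units are removed.\<close>
    define W where "W h u = h (u \<otimes> y) - g y * h u + E1 g y * E1 h u + E2 g y * E2 h u + E3 g y * E3 h u"
      for h u
    have W: "W \<in> Ops"
      unfolding W_def[abs_def] by (intro Ops_intros Ops Ops3 y)
    have trW: "W g \<one> = 0"
      using y orth by (simp add: W_def tr E3_def)
    have anti: "E (W k) u = - W (E k) u"
      if "E \<in> Ops" "E g \<one> = 0" "W (E g) \<one> = 0" "k \<in> solutions" "u \<in> carrier G" for E k u
      using Ops_anticommute[OF W that(1) trW that(2,4,5)] that(3) by simp
    have W1: "E1 (W k) u = - W (E1 k) u" if "k \<in> solutions" "u \<in> carrier G" for k u
      by (rule anti) (use that Ops tr orth y in \<open>simp_all add: W_def E3_def E21 E121\<close>)
    have W2: "E2 (W k) u = - W (E2 k) u" if "k \<in> solutions" "u \<in> carrier G" for k u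
      by (rule anti) (use that Ops tr orth y in \<open>simp_all add: W_def E3_def E122\<close>)
    have W3: "E3 (W k) u = - W (E3 k) u" if "k \<in> solutions" "u \<in> carrier G" for k u
      by (rule anti[OF Ops3]) (use that Ops tr orth y in \<open>simp_all add: W_def E3_def E112 E212 E1212\<close>)
    \<comment> \<open>Crossing \<open>E2\<close> and then \<open>E1\<close> changes the sign twice,
      so \<open>W\<close> also commutes with \<open>E3\<close>; with \<open>W3\<close> this kills
      \<open>E3 (W k)\<close>.\<close>
    have "E3 (W k) u = W (E3 k) u" if "k \<in> solutions" "u \<in> carrier G" for k u
    proof -
      have "E3 (W k) u = E1 (\<lambda>v. - W (E2 k) v) u"
        unfolding E3_def by (rule Ops_cong) (use Ops W2 that in auto)
      then show ?thesis
        using that Ops by (simp add: linear W1 Ops_solutions E3_def)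
    qed
    then have zero: "E3 (W k) u = 0" if "k \<in> solutions" "u \<in> carrier G" for k u
      using W3[OF that] that by auto
    \<comment> \<open>\<open>E3\<close> squares to \<open>-1\<close>, so \<open>W\<close> itself
      vanishes.\<close>
    have "W h x = - E3 (E3 (W h)) x"
      using Ops_solutions[OF W h] x by (simp add: E3_def E1212)
    also have "E3 (E3 (W h)) x = E3 (\<lambda>v. 0 * h v + 0 * h v) x"
      by (rule Ops_cong) (use Ops3 zero h x in auto)
    also have "\<dots> = 0"
      using Ops_linear[OF Ops3 x, of 0 h 0 h] by simp
    finally show ?thesis
      by (simp add: W_def algebra_simps eq_neg_iff_add_eq_0)
  qed
  \<comment> \<open>\<open>expand\<close> is applied to \<open>E1 g\<close>, \<open>E2 g\<close> and
    \<open>E3 g\<close>; the multiplication table above simplifies the products.\<close>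
  have "E1 g (x \<otimes> y) = g x * E1 g y + E1 g x * g y - E2 g x * E3 g y + E3 g x * E2 g y"
    "E2 g (x \<otimes> y) = g x * E2 g y + E1 g x * E3 g y + E2 g x * g y - E3 g x * E1 g y"
    "E3 g (x \<otimes> y) = g x * E3 g y - E1 g x * E2 g y + E2 g x * E1 g y + E3 g x * g y"
    if x: "x \<in> carrier G" and y: "y \<in> carrier G" for x y
    using expand[of "E1 g" x y] expand[of "E2 g" x y] expand[of "E3 g" x y] x y Ops Ops3
    by (simp_all add: Ops_solutions E11 E22 E21 E3_def E121 E122 E112 E212 E1212 mult.commute)
  moreover have "E3 g \<one> = 0"
    using orth by (simp add: E3_def)
  moreover have "E1 g x \<in> \<real> \<and> E2 g x \<in> \<real> \<and> E3 g x \<in> \<real>" if "x \<in> carrier G" for x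
    using real g_in_Reals that unfolding E3_def by blast
  ultimately have "quaternion_system G g E1 E2 E3"
    by unfold_locales (use Ops Ops3 tr expand in auto)
  then show ?thesis
    by (simp add: E3_def[abs_def])
qed

text \<open>The remainder \<open>W\<close> commutes with \<open>E\<close>, as translations commute,
  and anticommutes with it, being traceless and orthogonal to it. As \<open>E\<close> squares to
  \<open>-1\<close>, \<open>W\<close> is zero.\<close>

lemma quaternion_system_commuting:
  assumes E: "E \<in> Ops" "E g \<one> = 0" "E (E g) \<one> = - 1"
    and real: "\<And>x. x \<in> carrier G \<Longrightarrow> E g x \<in> \<real>"
    and commute: "\<And>h u x y. \<lbrakk>h \<in> solutions; u \<in> carrier G; x \<in> carrier G; y \<in> carrier G\<rbrakk>
      \<Longrightarrow> h (u \<otimes> x \<otimes> y) = h (u \<otimes> y \<otimes> x)"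
  shows "quaternion_system G g E (\<lambda>h u. 0) (\<lambda>h u. 0)"
proof -
  have EE: "E (E h) u = - h u" if "h \<in> solutions" "u \<in> carrier G" for h u
    using Ops_anticommute[OF E(1,1) E(2,2) that] E by simp
  have translate: "F (\<lambda>v. h (v \<otimes> y)) u = F h (u \<otimes> y)"
    if "F \<in> Ops" "h \<in> solutions" "u \<in> carrier G" "y \<in> carrier G" for F h u y
    using that
  proof (induction arbitrary: u rule: Ops.induct)
    case (translation x)
    then show ?case using commute by simp
  qed auto
  have expand: "h (x \<otimes> y) = g y * h x - E g y * E h x"
    if h: "h \<in> solutions" and x: "x \<in> carrier G" and y: "y \<in> carrier G" for h x y
  proof -
    define W where "W h u = h (u \<otimes> y) - g y * h u + E g y * E h u" for h u
    have W: "W \<in> Ops"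
      unfolding W_def[abs_def] by (intro Ops_intros E y)
    have trW: "W g \<one> = 0" "W (E g) \<one> = 0"
      using y E by (simp_all add: W_def)
    have "E (W (E h)) x = W (E (E h)) x"
    proof -
      define k where "k = E h"
      have k: "k \<in> solutions"
        unfolding k_def by (rule Ops_solutions[OF E(1) h])
      have "E (W k) x = E (\<lambda>v. 1 * k (v \<otimes> y) + 1 * ((- g y) * k v + E g y * E k v)) x"
        by (rule Ops_cong[OF E(1) _ x]) (simp add: W_def)
      also have "\<dots> = W (E k) x"
        unfolding Ops_linear[OF E(1) x] using x y k E by (simp add: translate W_def)
      finally show ?thesis unfolding k_def .
    qed
    moreover have "W (E (E h)) x = - E (W (E h)) x"
      using Ops_anticommute[OF E(1) W E(2) trW(1) Ops_solutions[OF E(1) h] x]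
        Ops_trace_commute[OF E(1) W] trW by simp
    ultimately have "W (E (E h)) x = 0"
      by simp
    moreover have "W (E (E h)) x = W (\<lambda>v. (- 1) * h v + 0 * h v) x"
      by (rule Ops_cong[OF W _ x]) (simp add: EE h)
    ultimately have "W h x = 0"
      unfolding Ops_linear[OF W x] by simp
    then show ?thesis
      by (simp add: W_def algebra_simps eq_neg_iff_add_eq_0)
  qed
  have zero: "(\<lambda>h u. 0) \<in> Ops"
    using Ops_scale[OF Ops_id, of 0] by simp
  show ?thesis
  proof unfold_locales
    fix x y assume "x \<in> carrier G" "y \<in> carrier G"
    then show "E g (x \<otimes> y) = g x * E g y + E g x * g y - 0 * 0 + 0 * 0"
      using expand[of "E g" x y] Ops_solutions[OF E(1) g_in_solutions] by (simp add: EE mult.commute)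
  qed (use E real zero expand in auto)
qed

text \<open>Here \<open>g (y \<otimes> y) = 1\<close>, so \<open>y \<otimes> y\<close> acts
  trivially, and \<open>solutions_square\<close> turns translation by \<open>y\<close> into the
  scalar \<open>g y\<close>.\<close>

lemma quaternion_system_scalar:
  assumes "\<And>x. x \<in> carrier G \<Longrightarrow> (g x)\<^sup>2 = 1"
  shows "quaternion_system G g (\<lambda>h u. 0) (\<lambda>h u. 0) (\<lambda>h u. 0)"
proof -
  have "h (x \<otimes> y) = g y * h x" if "h \<in> solutions" "x \<in> carrier G" "y \<in> carrier G" for h x y
  proof -
    have "g (y \<otimes> y) = 1"
      using solutions_square[of g \<one> y] assms[OF that(3)] that by (simp add: power2_eq_square)
    then have "h (x \<otimes> y \<otimes> y) = h x"
      using solutions_fixed[of h x "y \<otimes> y"] that by (simp add: m_assoc)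
    then have "h x = g y * h (x \<otimes> y)"
      using solutions_square[OF that] by (simp add: mult.assoc)
    then have "g y * h x = (g y)\<^sup>2 * h (x \<otimes> y)"
      by (simp add: power2_eq_square)
    then show ?thesis
      by (simp add: assms that)
  qed
  moreover have "(\<lambda>h u. 0) \<in> Ops"
    using Ops_scale[OF Ops_id, of 0] by simp
  ultimately show ?thesis
    by unfold_locales auto
qed

text \<open>The traceless part of translation by \<open>a\<close> squares to
  \<open>(g a)\<^sup>2 - 1\<close>; dividing by the real \<open>s\<close> normalizes it and
  preserves realness.\<close>

lemma normalized_translation:
  fixes s :: real
  assumes a: "a \<in> carrier G" and s: "complex_of_real (s\<^sup>2) = 1 - (g a)\<^sup>2" "s \<noteq> 0"
    and E_def: "E = (\<lambda>h u. (h (u \<otimes> a) - g a * h u) / complex_of_real s)"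
  shows "E \<in> Ops" "E g \<one> = 0" "E (E g) \<one> = - 1"
    and "\<And>h x. \<lbrakk>\<And>y. y \<in> carrier G \<Longrightarrow> h y \<in> \<real>; x \<in> carrier G\<rbrakk> \<Longrightarrow> E h x \<in> \<real>"
proof -
  show "E \<in> Ops"
    unfolding E_def by (intro Ops_intros a)
  show E1: "E g \<one> = 0"
    using a by (simp add: E_def)
  have "g (a \<otimes> a) = 2 * (g a)\<^sup>2 - 1"
    using solutions_square[of g \<one> a] a by (simp add: power2_eq_square)
  then have "E g a = - (complex_of_real (s\<^sup>2) / complex_of_real s)"
    unfolding s E_def by (simp add: power2_eq_square diff_divide_distrib)
  also have "\<dots> = - complex_of_real s"
    by (simp add: power2_eq_square)
  finally have "E g a - g a * E g \<one> = - complex_of_real s"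
    by (simp add: E1)
  then show "E (E g) \<one> = - 1"
    using a s(2) by (subst E_def) simp
  show "E h x \<in> \<real>" if "\<And>y. y \<in> carrier G \<Longrightarrow> h y \<in> \<real>" "x \<in> carrier G" for h x
    using that a g_in_Reals by (simp add: E_def)
qed

lemma quaternion_system_exists: "\<exists>E1 E2 E3. quaternion_system G g E1 E2 E3"
proof -
  define r where "r x = Re (g x)" for x
  have gr: "g x = complex_of_real (r x)" and r1: "(r x)\<^sup>2 \<le> 1" if "x \<in> carrier G" for x
    using g_real[OF that] by (auto simp: r_def complex_eq_iff abs_square_le_1)
  have sqrt1: "complex_of_real ((sqrt (1 - (r x)\<^sup>2))\<^sup>2) = 1 - (g x)\<^sup>2" if "x \<in> carrier G" for x
    using gr[OF that] r1[OF that] by simp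
  \<comment> \<open>The bracket of \<open>g_commutator\<close> in real terms; it is nonnegative
    because \<open>g\<close> is at most \<open>1\<close> at the commutator.\<close>
  define gram where "gram x y = 1 - (r x)\<^sup>2 - (r y)\<^sup>2 + 2 * r x * r y * r (x \<otimes> y) - (r (x \<otimes> y))\<^sup>2" for x y
  have gcomm: "g (x \<otimes> y \<otimes> inv (y \<otimes> x)) = complex_of_real (1 - 2 * gram x y)"
    if "x \<in> carrier G" "y \<in> carrier G" for x y
    unfolding g_commutator[OF that] using that by (simp add: gram_def gr)
  have gram_nonneg: "gram x y \<ge> 0" if "x \<in> carrier G" "y \<in> carrier G" for x y
    using g_real(2)[of "x \<otimes> y \<otimes> inv (y \<otimes> x)"] that by (simp add: gcomm)
  consider (scalar) "\<And>x. x \<in> carrier G \<Longrightarrow> (g x)\<^sup>2 = 1"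
    | (commuting) a where "a \<in> carrier G" "(g a)\<^sup>2 \<noteq> 1"
      "\<And>x y. \<lbrakk>x \<in> carrier G; y \<in> carrier G\<rbrakk> \<Longrightarrow> gram x y = 0"
    | (noncommuting) a b where "a \<in> carrier G" "b \<in> carrier G" "gram a b \<noteq> 0"
    by blast
  then show ?thesis
  proof cases
    case scalar
    then show ?thesis using quaternion_system_scalar by blast
  next
    case (commuting a)
    have commute: "h (u \<otimes> x \<otimes> y) = h (u \<otimes> y \<otimes> x)"
      if h: "h \<in> solutions" and [simp]: "u \<in> carrier G" "x \<in> carrier G" "y \<in> carrier G" for h u x y
    proof -
      \<comment> \<open>Since \<open>gram x y = 0\<close>, \<open>g\<close> is \<open>1\<close> at
        the commutator, which therefore acts trivially.\<close>
      have "h (u \<otimes> (x \<otimes> y \<otimes> inv (y \<otimes> x)) \<otimes> (y \<otimes> x)) = h (u \<otimes> (y \<otimes> x))"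
        using solutions_fixed[OF solutions_translation[OF h, of "y \<otimes> x"], of u "x \<otimes> y \<otimes> inv (y \<otimes> x)"]
          gcomm[of x y] commuting(3)[of x y] by simp
      then show ?thesis
        by (simp add: m_assoc)
    qed
    have "sqrt (1 - (r a)\<^sup>2) \<noteq> 0"
      using commuting(1,2) by (simp add: gr flip: of_real_power)
    note E = normalized_translation[OF commuting(1) sqrt1[OF commuting(1)] this refl]
    show ?thesis
      using quaternion_system_commuting[OF E(1-3) E(4)[OF g_in_Reals] commute] by blast
  next
    case (noncommuting a b)
    define s where "s = sqrt (1 - (r a)\<^sup>2)"
    have [simp]: "a \<in> carrier G" "b \<in> carrier G" by fact+
    have gram: "gram a b > 0"
      using gram_nonneg[of a b] noncommuting by simp
    have "(r a)\<^sup>2 \<noteq> 1"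
    proof
      assume 1: "(r a)\<^sup>2 = 1"
      \<comment> \<open>With \<open>(r a)\<^sup>2 = 1\<close> this is minus a square, against
        \<open>gram a b > 0\<close>.\<close>
      have "gram a b = (1 - (r a)\<^sup>2) * (1 - (r (a \<otimes> b))\<^sup>2) - (r b - r a * r (a \<otimes> b))\<^sup>2"
        unfolding gram_def by algebra
      then show False
        using gram by (simp add: 1)
    qed
    then have s: "s > 0" "s\<^sup>2 = 1 - (r a)\<^sup>2"
      using r1[of a] by (simp_all add: s_def)
    \<comment> \<open>Gram-Schmidt: \<open>k\<close> is the component of translation by
      \<open>b\<close> along \<open>E1\<close>, and \<open>t\<close> below is the length of what
      remains after removing \<open>g b\<close> and \<open>k\<close> times
      \<open>E1\<close>.\<close>
    define k where "k = (r a * r b - r (a \<otimes> b)) / s"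
    have "s\<^sup>2 * (1 - (r b)\<^sup>2 - k\<^sup>2) = gram a b"
    proof -
      have "s * k = r a * r b - r (a \<otimes> b)"
        using s by (simp add: k_def)
      then show ?thesis
        using s(2) unfolding gram_def by algebra
    qed
    then have pos: "1 - (r b)\<^sup>2 - k\<^sup>2 > 0"
      using gram s by (metis zero_less_mult_pos zero_less_power)
    define t where "t = sqrt (1 - (r b)\<^sup>2 - k\<^sup>2)"
    have t: "t > 0" "t\<^sup>2 = 1 - (r b)\<^sup>2 - k\<^sup>2"
      using pos by (simp_all add: t_def)
    define E1 where "E1 = (\<lambda>h u. (h (u \<otimes> a) - g a * h u) / complex_of_real s)"
    define E2 where "E2 = (\<lambda>h u. (h (u \<otimes> b) - g b * h u - complex_of_real k * E1 h u) / complex_of_real t)"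
    have "complex_of_real (s\<^sup>2) = 1 - (g a)\<^sup>2" "s \<noteq> 0"
      using s by (simp_all add: gr)
    note E1 = normalized_translation[OF \<open>a \<in> carrier G\<close> this E1_def]
    have E2: "E2 \<in> Ops"
      unfolding E2_def by (intro Ops_intros E1(1)) simp
    have E2tr: "E2 g \<one> = 0"
      by (simp add: E2_def E1)
    have "r (b \<otimes> a) = r (a \<otimes> b)"
      by (simp add: r_def g_commute[of b a])
    then have E1b: "E1 g b = - complex_of_real k"
      using s by (simp add: E1_def k_def gr field_simps)
    \<comment> \<open>In this order, unfolding the outer \<open>E2\<close> needs only known values
      of \<open>E1\<close>; the other order follows by symmetry of the trace.\<close>
    have orth: "E2 (E1 g) \<one> = 0"
      by (simp add: E2_def E1 E1b)
    then have orth': "E1 (E2 g) \<one> = 0"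
      using Ops_trace_commute[OF E1(1) E2] by simp
    have "g (b \<otimes> b) = 2 * (g b)\<^sup>2 - 1"
      using solutions_square[of g \<one> b] by (simp add: power2_eq_square)
    then have "E2 g b = complex_of_real ((r b)\<^sup>2 - 1 + k\<^sup>2) / complex_of_real t"
      by (simp add: E2_def E1b gr power2_eq_square)
    also have "(r b)\<^sup>2 - 1 + k\<^sup>2 = - (t * t)"
      using t(2) by (simp add: power2_eq_square)
    finally have "E2 g b = - complex_of_real t"
      using t by simp
    then have "E2 (E2 g) \<one> = (- complex_of_real t - g b * E2 g \<one> - complex_of_real k * E1 (E2 g) \<one>)
        / complex_of_real t"
      by (subst E2_def) simp
    then have orth'': "E2 (E2 g) \<one> = - 1"
      using t by (simp add: orth' E2tr)
    have real: "E2 h x \<in> \<real>" if "\<And>y. y \<in> carrier G \<Longrightarrow> h y \<in> \<real>" "x \<in> carrier G" for h x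
      using that E1(4)[OF that] g_in_Reals by (simp add: E2_def)
    show ?thesis
      using quaternion_system_noncommuting[OF E1(1) E2 E1(2) E2tr E1(3) orth'' orth' E1(4) real] by blast
  qed
qed

end

theorem theorem3p3:
  fixes G :: "('a, 'b) monoid_scheme" and T :: "'a topology"
    and f g :: "'a \<Rightarrow> complex"
  assumes "compact_group G T"
    and "continuous_map T euclidean f"
    and "continuous_map T euclidean g"
    and "\<And>x y. \<lbrakk>x \<in> carrier G; y \<in> carrier G\<rbrakk> \<Longrightarrow>
           f (x \<otimes>\<^bsub>G\<^esub> y) + f (x \<otimes>\<^bsub>G\<^esub> inv\<^bsub>G\<^esub> y) = 2 * f x * g y"
  shows "(\<forall>x\<in>carrier G. f x = 0) \<or>
         (\<exists>\<phi> (A :: complex^2^2). SU2_representation G T \<phi> \<and>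
            (\<forall>x\<in>carrier G. f x = trace (A ** \<phi> x) \<and> g x = rep_character \<phi> x / 2))"
proof (cases "\<forall>x\<in>carrier G. f x = 0")
  case False
  then obtain x0 where x0: "x0 \<in> carrier G" "f x0 \<noteq> 0" by blast
  interpret compact_group G T by fact
  note wilson = wilson_dalembert[OF is_group assms(4) x0]
  \<comment> \<open>Compactness turns continuity of \<open>f\<close> and \<open>g\<close> into the
    boundedness that \<open>solutions\<close> and \<open>dalembert_function\<close> require.\<close>
  have bounded: "\<exists>B. \<forall>x\<in>carrier G. cmod (h x) \<le> B" if "continuous_map T euclidean h" for h
    using continuous_map_compact_bounded[OF compact that] by (simp add: bounded_iff topspace_eq)
  interpret dalembert_function G g
    by unfold_locales (use bounded[OF assms(3)] wilson in auto)
  have "f \<in> solutions"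
    unfolding solutions_def using bounded[OF assms(2)] wilson(4) by blast
  moreover obtain E1 E2 E3 where "quaternion_system G g E1 E2 E3"
    using quaternion_system_exists by blast
  ultimately show ?thesis
    using quaternion_system.SU2_representation_exists[OF _ topological_group_axioms assms(3)] by blast
qed blast

end
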